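(* Let $A$ and $B$ be two rings, $J$ an ideal of $B$, and let $f: A \to B$ be a ring homomorphism. Then $A \bowtie^{f} J$ is a Von Neumann regular ring if and only if the following statements hold: (1) $A$ is a Von Neumann regular ring. (2) $\mathrm{Nilp}(B) \cap J = \{0\}$. (3) Every prime ideal of $B$ which does not contain $J$ is maximal.
   Context: All rings are commutative with identity. For a ring homomorphism $f: A \to B$ and an ideal $J$ of $B$, the amalgamation of $A$ with $B$ along $J$ with respect to $f$ is the subring $A \bowtie^{f} J := \{(a, f(a)+j) \mid a \in A,\ j \in J\}$ of $A \times B$. A ring $R$ is Von Neumann regular if for each $a \in R$ there exists $x \in R$ with $axa = a$. $\mathrm{Nilp}(B)$ denotes the set of nilpotent elements of $B$ (the nilradical of $B$). *)

theory Defs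
  imports "HOL-Algebra.Chinese_Remainder" "HOL-Algebra.Subrings"
begin

definition amalgamation ::
  "('a, 'm) ring_scheme \<Rightarrow> ('b, 'n) ring_scheme \<Rightarrow> 'b set \<Rightarrow> ('a \<Rightarrow> 'b) \<Rightarrow> ('a \<times> 'b) ring" where
  "amalgamation A B J f =
     (RDirProd A B)\<lparr>carrier := {(a, f a \<oplus>\<^bsub>B\<^esub> j) | a j. a \<in> carrier A \<and> j \<in> J}\<rparr>"

definition Nilp :: "('a, 'm) ring_scheme \<Rightarrow> 'a set" where
  "Nilp R = {x \<in> carrier R. \<exists>n::nat. 0 < n \<and> x [^]\<^bsub>R\<^esub> n = \<zero>\<^bsub>R\<^esub>}"

(* As in HOL-Algebra, the zero ring is a cring, hence a Von Neumann regular ring. *)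
locale von_neumann_regular_ring = cring +
  assumes regular: "a \<in> carrier R \<Longrightarrow> \<exists>x \<in> carrier R. a \<otimes> x \<otimes> a = a"

lemma RDirProd_cring:
  assumes "cring A" and "cring B"
  shows "cring (RDirProd A B)"
proof -
  interpret A: cring A by fact
  interpret B: cring B by fact
  interpret P: ring "RDirProd A B"
    by (rule RDirProd_ring) (rule A.ring_axioms, rule B.ring_axioms)
  show ?thesis
    by unfold_locales
      (auto simp: RDirProd_def DirProd_def monoid.defs A.m_comm B.m_comm)
qed

lemma amalgamation_subring:
  assumes "cring A" and "cring B" and "ideal J B" and "f \<in> ring_hom A B"
  shows "subring (carrier (amalgamation A B J f)) (RDirProd A B)"
proof -
  interpret A: cring A by fact
  interpret B: cring B by fact
  interpret J: ideal J B by fact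
  interpret P: cring "RDirProd A B" using assms by (intro RDirProd_cring)
  interpret f: ring_hom_cring A B f
    by unfold_locales (rule assms)
  let ?P = "RDirProd A B" and ?S = "carrier (amalgamation A B J f)"
  have S: "?S = {(a, f a \<oplus>\<^bsub>B\<^esub> j) | a j. a \<in> carrier A \<and> j \<in> J}"
    by (simp add: amalgamation_def)
  have car: "carrier ?P = carrier A \<times> carrier B"
    and one: "\<one>\<^bsub>?P\<^esub> = (\<one>\<^bsub>A\<^esub>, \<one>\<^bsub>B\<^esub>)"
    and zero: "\<zero>\<^bsub>?P\<^esub> = (\<zero>\<^bsub>A\<^esub>, \<zero>\<^bsub>B\<^esub>)"
    and mult: "\<And>a b c d. (a, b) \<otimes>\<^bsub>?P\<^esub> (c, d) = (a \<otimes>\<^bsub>A\<^esub> c, b \<otimes>\<^bsub>B\<^esub> d)"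
    and add: "\<And>a b c d. (a, b) \<oplus>\<^bsub>?P\<^esub> (c, d) = (a \<oplus>\<^bsub>A\<^esub> c, b \<oplus>\<^bsub>B\<^esub> d)"
    by (auto simp: RDirProd_def DirProd_def monoid.defs)
  note [simp] = J.a_Hcarr
  have neg: "\<ominus>\<^bsub>?P\<^esub> (a, b) = (\<ominus>\<^bsub>A\<^esub> a, \<ominus>\<^bsub>B\<^esub> b)" if "a \<in> carrier A" "b \<in> carrier B" for a b
    by (rule P.minus_equality) (use that in \<open>auto simp: car zero add A.l_neg B.l_neg\<close>)
  show ?thesis
  proof (rule P.subringI)
    show "?S \<subseteq> carrier ?P" by (auto simp: S car)
    show "\<one>\<^bsub>?P\<^esub> \<in> ?S"
      unfolding S one
      by (auto intro!: exI[of _ "\<zero>\<^bsub>B\<^esub>"])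
  next
    fix h assume "h \<in> ?S"
    then obtain a j where h: "h = (a, f a \<oplus>\<^bsub>B\<^esub> j)" "a \<in> carrier A" "j \<in> J" by (auto simp: S)
    then have "\<ominus>\<^bsub>?P\<^esub> h = (\<ominus>\<^bsub>A\<^esub> a, f (\<ominus>\<^bsub>A\<^esub> a) \<oplus>\<^bsub>B\<^esub> (\<ominus>\<^bsub>B\<^esub> j))"
      by (simp add: neg B.minus_add)
    then show "\<ominus>\<^bsub>?P\<^esub> h \<in> ?S" unfolding S using h by fastforce
  next
    fix h k assume "h \<in> ?S" "k \<in> ?S"
    then obtain a j b i
      where h: "h = (a, f a \<oplus>\<^bsub>B\<^esub> j)" "a \<in> carrier A" "j \<in> J"
        and k: "k = (b, f b \<oplus>\<^bsub>B\<^esub> i)" "b \<in> carrier A" "i \<in> J" by (auto simp: S)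
    have "h \<oplus>\<^bsub>?P\<^esub> k = (a \<oplus>\<^bsub>A\<^esub> b, f (a \<oplus>\<^bsub>A\<^esub> b) \<oplus>\<^bsub>B\<^esub> (j \<oplus>\<^bsub>B\<^esub> i))"
      using h k by (simp add: add B.a_ac)
    then show "h \<oplus>\<^bsub>?P\<^esub> k \<in> ?S" unfolding S using h k by fastforce
    have "h \<otimes>\<^bsub>?P\<^esub> k = (a \<otimes>\<^bsub>A\<^esub> b, f (a \<otimes>\<^bsub>A\<^esub> b) \<oplus>\<^bsub>B\<^esub>
        (f a \<otimes>\<^bsub>B\<^esub> i \<oplus>\<^bsub>B\<^esub> j \<otimes>\<^bsub>B\<^esub> f b \<oplus>\<^bsub>B\<^esub> j \<otimes>\<^bsub>B\<^esub> i))"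
      using h k by (simp add: mult B.l_distr B.r_distr B.a_ac)
    moreover have "f a \<otimes>\<^bsub>B\<^esub> i \<oplus>\<^bsub>B\<^esub> j \<otimes>\<^bsub>B\<^esub> f b \<oplus>\<^bsub>B\<^esub> j \<otimes>\<^bsub>B\<^esub> i \<in> J"
      using h k by (intro J.a_closed J.I_l_closed J.I_r_closed) auto
    ultimately show "h \<otimes>\<^bsub>?P\<^esub> k \<in> ?S" unfolding S using h k by fastforce
  qed
qed

lemma amalgamation_cring:
  assumes "cring A" and "cring B" and "ideal J B" and "f \<in> ring_hom A B"
  shows "cring (amalgamation A B J f)"
proof -
  interpret P: cring "RDirProd A B" using assms(1,2) by (rule RDirProd_cring)
  have "subcring (carrier (amalgamation A B J f)) (RDirProd A B)"
    using amalgamation_subring[OF assms] by (rule P.subcringI')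
  then have "cring ((RDirProd A B)\<lparr>carrier := carrier (amalgamation A B J f)\<rparr>)"
    using P.subcring_iff subcringE(1) P.subcringI' by (metis subringE(1) amalgamation_subring[OF assms])
  then show ?thesis by (simp add: amalgamation_def)
qed

end

theory Submission
  imports Defs "HOL-Algebra.Ring_Divisibility"
begin

text \<open>The bridge between the two sides is the condition that every \<open>j \<in> J\<close> is a regular element
  of \<open>B\<close>, that is, has a quasi-inverse \<open>y\<close> in \<open>B\<close> with \<open>j y j = j\<close>.

  The first projection maps \<open>A \<bowtie>\<^sup>f J\<close> onto \<open>A\<close> with kernel \<open>0 \<times> J\<close>, and regularity behaves well
  under extensions: a ring is Von Neumann regular exactly if a quotient of it is and all elements of
  the kernel are regular (\<open>von_neumann_regular_extension\<close>, resting on McCoy's lemma). Regularity of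
  \<open>(0, j)\<close> in the amalgamation amounts to regularity of \<open>j\<close> in \<open>B\<close>. So \<open>A \<bowtie>\<^sup>f J\<close> is regular if and
  only if \<open>A\<close> is and \<open>J\<close> consists of regular elements of \<open>B\<close>.

  What remains is a statement about \<open>B\<close> and \<open>J\<close> alone (\<open>ideal_regular_iff\<close>): an ideal consists of
  regular elements if and only if it contains no nonzero nilpotents and all primes not containing it
  are maximal. This is the relative form of the theorem that the Von Neumann regular rings are the
  reduced rings of Krull dimension at most zero. For the harder direction, a suitable multiplicative
  set attached to \<open>j\<close> has to contain \<open>0\<close>, since a prime avoiding it would contradict maximality
  (\<open>vnr_element_if_primes_maximal\<close>).\<close>

section \<open>Prime ideals avoiding a multiplicative set\<close>

lemma (in cring) ideal_add_cgenideal: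
  assumes I: "ideal I R" and a: "a \<in> carrier R"
  shows "ideal (I <+>\<^bsub>R\<^esub> PIdl a) R"
    and "x \<in> I <+>\<^bsub>R\<^esub> PIdl a \<longleftrightarrow> (\<exists>i\<in>I. \<exists>r\<in>carrier R. x = i \<oplus> r \<otimes> a)"
    and "I \<subseteq> I <+>\<^bsub>R\<^esub> PIdl a"
    and "a \<in> I <+>\<^bsub>R\<^esub> PIdl a"
proof -
  interpret I: ideal I R by fact
  show "ideal (I <+>\<^bsub>R\<^esub> PIdl a) R" by (intro add_ideals I cgenideal_ideal a)
  have mem: "x \<in> I <+>\<^bsub>R\<^esub> PIdl a \<longleftrightarrow> (\<exists>i\<in>I. \<exists>r\<in>carrier R. x = i \<oplus> r \<otimes> a)" for x
    unfolding set_add_def' cgenideal_def by blast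
  then show "x \<in> I <+>\<^bsub>R\<^esub> PIdl a \<longleftrightarrow> (\<exists>i\<in>I. \<exists>r\<in>carrier R. x = i \<oplus> r \<otimes> a)" .
  show "I \<subseteq> I <+>\<^bsub>R\<^esub> PIdl a"
  proof
    fix i assume "i \<in> I"
    then show "i \<in> I <+>\<^bsub>R\<^esub> PIdl a"
      unfolding mem using a by (intro bexI[of _ i] bexI[of _ \<zero>]) (auto dest: I.Icarr)
  qed
  show "a \<in> I <+>\<^bsub>R\<^esub> PIdl a"
    unfolding mem using a by (intro bexI[of _ \<zero>] bexI[of _ \<one>]) auto
qed

text \<open>Krull's argument: an ideal that is maximal among those disjoint from \<open>S\<close> is prime. If
  \<open>a\<close> and \<open>b\<close> lie outside it, then both enlargements \<open>P + (a)\<close> and \<open>P + (b)\<close> meet \<open>S\<close>, and the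
  product of the two elements found there lies in \<open>P + (a b)\<close>.\<close>

lemma (in cring) exists_primeideal_avoiding:
  assumes I: "ideal I R" and IS: "I \<inter> S = {}" and S: "S \<subseteq> carrier R"
    and one: "\<one> \<in> S" and mult: "\<And>s t. s \<in> S \<Longrightarrow> t \<in> S \<Longrightarrow> s \<otimes> t \<in> S"
  obtains P where "primeideal P R" "I \<subseteq> P" "P \<inter> S = {}"
proof -
  define F where "F = {K. ideal K R \<and> I \<subseteq> K \<and> K \<inter> S = {}}"
  have "\<exists>P\<in>F. \<forall>K\<in>F. P \<subseteq> K \<longrightarrow> K = P"
  proof (rule subset_Zorn_nonempty)
    show "F \<noteq> {}" using I IS by (auto simp: F_def)
  next
    fix C assume C: "C \<noteq> {}" "subset.chain F C"
    then have "C \<subseteq> F" by (simp add: subset_chain_def)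
    moreover have "ideal (\<Union>C) R"
      using C chain_Union_is_ideal[of C] by (auto simp: subset_chain_def F_def)
    ultimately show "\<Union>C \<in> F" using C(1) by (auto simp: F_def)
  qed
  then obtain P where PF: "P \<in> F" and max: "\<And>K. K \<in> F \<Longrightarrow> P \<subseteq> K \<Longrightarrow> K = P" by blast
  then interpret P: ideal P R by (simp add: F_def)
  have enlarge: "\<exists>p\<in>P. \<exists>r\<in>carrier R. p \<oplus> r \<otimes> a \<in> S" if a: "a \<in> carrier R" "a \<notin> P" for a
  proof -
    let ?K = "P <+>\<^bsub>R\<^esub> PIdl a"
    note K = ideal_add_cgenideal[OF P.is_ideal a(1)]
    have "?K \<notin> F" using max[of ?K] K(3,4) a(2) by blast
    then have "?K \<inter> S \<noteq> {}" using K(1,3) PF by (auto simp: F_def)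
    then obtain x where "x \<in> ?K" "x \<in> S" by blast
    then show ?thesis using K(2)[of x] by blast
  qed
  have "primeideal P R"
  proof (rule primeidealI[OF P.is_ideal is_cring])
    show "carrier R \<noteq> P" using PF one by (auto simp: F_def)
  next
    fix a b assume ab: "a \<in> carrier R" "b \<in> carrier R" "a \<otimes> b \<in> P"
    show "a \<in> P \<or> b \<in> P"
    proof (rule ccontr)
      assume "\<not> (a \<in> P \<or> b \<in> P)"
      then obtain p r q s where pr: "p \<in> P" "r \<in> carrier R" "p \<oplus> r \<otimes> a \<in> S"
        and qs: "q \<in> P" "s \<in> carrier R" "q \<oplus> s \<otimes> b \<in> S"
        using enlarge ab by meson
      have pq: "p \<in> carrier R" "q \<in> carrier R" using pr qs P.Icarr by auto
      have "(p \<oplus> r \<otimes> a) \<otimes> (q \<oplus> s \<otimes> b) =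
          p \<otimes> (q \<oplus> s \<otimes> b) \<oplus> (r \<otimes> a) \<otimes> q \<oplus> (r \<otimes> s) \<otimes> (a \<otimes> b)"
        using ab pr(2) qs(2) pq by algebra
      also have "\<dots> \<in> P"
        using ab pr qs pq
        by (intro P.a_closed P.I_r_closed[OF pr(1)] P.I_l_closed[OF qs(1)] P.I_l_closed[OF ab(3)])
          auto
      finally show False using mult[OF pr(3) qs(3)] PF by (auto simp: F_def)
    qed
  qed
  then show ?thesis using that PF by (auto simp: F_def)
qed

section \<open>Von Neumann regular elements\<close>

definition vnr_element :: "('a, 'm) ring_scheme \<Rightarrow> 'a \<Rightarrow> bool" where
  "vnr_element R a \<longleftrightarrow> (\<exists>x\<in>carrier R. a \<otimes>\<^bsub>R\<^esub> x \<otimes>\<^bsub>R\<^esub> a = a)"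

lemma (in cring) von_neumann_regular_ring_iff:
  "von_neumann_regular_ring R \<longleftrightarrow> (\<forall>a\<in>carrier R. vnr_element R a)"
  unfolding von_neumann_regular_ring_def von_neumann_regular_ring_axioms_def vnr_element_def
  using is_cring by blast

text \<open>McCoy's lemma: if \<open>y\<close> is a quasi-inverse of the defect \<open>p - p u p\<close>, then expanding
  \<open>p = p u p + (p - p u p) y (p - p u p)\<close> and factoring out \<open>p\<close> on both sides gives the
  quasi-inverse \<open>u + (1 - u p) y (1 - p u)\<close> of \<open>p\<close>.\<close>

lemma (in cring) vnr_element_if_defect_regular:
  assumes [simp]: "p \<in> carrier R" "u \<in> carrier R" and reg: "vnr_element R (p \<ominus> p \<otimes> u \<otimes> p)"
  shows "vnr_element R p"
proof -
  let ?d = "p \<ominus> p \<otimes> u \<otimes> p"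
  obtain y where y: "y \<in> carrier R" "?d \<otimes> y \<otimes> ?d = ?d"
    using reg by (auto simp: vnr_element_def)
  let ?w = "u \<oplus> (\<one> \<ominus> u \<otimes> p) \<otimes> y \<otimes> (\<one> \<ominus> p \<otimes> u)"
  have "p \<otimes> ?w \<otimes> p = p \<otimes> u \<otimes> p \<oplus> ?d \<otimes> y \<otimes> ?d"
    using assms(1,2) y(1) by algebra
  also have "\<dots> = p"
    unfolding y(2) using assms(1,2) by algebra
  finally show ?thesis using y(1) by (auto simp: vnr_element_def intro!: bexI[of _ ?w])
qed

text \<open>Regularity passes to the image elementwise. Conversely, lifting a quasi-inverse of the image
  of \<open>p\<close> makes the defect of \<open>p\<close> an element of the kernel, so McCoy's lemma applies.\<close>

lemma (in ring_hom_cring) von_neumann_regular_extension: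
  assumes surj: "h ` carrier R = carrier S"
  shows "von_neumann_regular_ring R \<longleftrightarrow>
    von_neumann_regular_ring S \<and> (\<forall>k\<in>a_kernel R S h. vnr_element R k)"
proof (intro iffI conjI)
  assume reg: "von_neumann_regular_ring R"
  then show "\<forall>k\<in>a_kernel R S h. vnr_element R k"
    unfolding R.von_neumann_regular_ring_iff a_kernel_def' by blast
  show "von_neumann_regular_ring S"
    unfolding S.von_neumann_regular_ring_iff
  proof
    fix b assume "b \<in> carrier S"
    then obtain a where a: "a \<in> carrier R" "b = h a" using surj by auto
    then obtain x where x: "x \<in> carrier R" "a \<otimes> x \<otimes> a = a"
      using reg unfolding R.von_neumann_regular_ring_iff vnr_element_def by blast
    then have "h a \<otimes>\<^bsub>S\<^esub> h x \<otimes>\<^bsub>S\<^esub> h a = h a"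
      using a by (metis R.m_closed hom_mult)
    then show "vnr_element S b" using a x by (auto simp: vnr_element_def)
  qed
next
  assume asm: "von_neumann_regular_ring S \<and> (\<forall>k\<in>a_kernel R S h. vnr_element R k)"
  show "von_neumann_regular_ring R"
    unfolding R.von_neumann_regular_ring_iff
  proof
    fix p assume p: "p \<in> carrier R"
    then have "vnr_element S (h p)"
      using asm S.von_neumann_regular_ring_iff hom_closed by blast
    then obtain v where v: "v \<in> carrier S" "h p \<otimes>\<^bsub>S\<^esub> v \<otimes>\<^bsub>S\<^esub> h p = h p"
      unfolding vnr_element_def by blast
    obtain u where u: "u \<in> carrier R" "h u = v" using v(1) surj by (metis imageE)
    have "h (p \<ominus> p \<otimes> u \<otimes> p) = \<zero>\<^bsub>S\<^esub>"
      using p u v by (simp add: a_minus_def S.r_neg)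
    moreover have "p \<ominus> p \<otimes> u \<otimes> p \<in> carrier R" using p u(1) by simp
    ultimately have "p \<ominus> p \<otimes> u \<otimes> p \<in> a_kernel R S h" unfolding a_kernel_def' by blast
    then show "vnr_element R p" using R.vnr_element_if_defect_regular p u asm by blast
  qed
qed

section \<open>Ideals of regular elements\<close>

text \<open>A regular element with quasi-inverse \<open>y\<close> satisfies \<open>j = j\<^sup>n\<^sup>+\<^sup>1 y\<^sup>n\<close> for every
  \<open>n\<close>, so it cannot be nilpotent unless it vanishes.\<close>

lemma (in cring) vnr_nilpotent_eq_zero:
  assumes j: "j \<in> carrier R" "vnr_element R j" and "j \<in> Nilp R"
  shows "j = \<zero>"
proof -
  obtain y where y: "y \<in> carrier R" "j \<otimes> y \<otimes> j = j" using j by (auto simp: vnr_element_def)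
  obtain n :: nat where n: "j [^] n = \<zero>" using assms(3) by (auto simp: Nilp_def)
  have "j = j \<otimes> (j [^] k \<otimes> y [^] k)" for k :: nat
  proof (induction k)
    case 0
    then show ?case using j by simp
  next
    case (Suc k)
    have "j \<otimes> (j [^] Suc k \<otimes> y [^] Suc k) = (j \<otimes> (j [^] k \<otimes> y [^] k)) \<otimes> y \<otimes> j"
      using j y(1) by (simp add: m_ac)
    also have "\<dots> = j" using Suc.IH y(2) by simp
    finally show ?case ..
  qed
  from this[of n] show ?thesis using n j y by simp
qed

text \<open>Regularity of \<open>c\<close> puts \<open>c (1 - y c) = 0\<close> into every prime ideal, so \<open>1 - y c\<close> lies in each
  prime that avoids \<open>c\<close>. To see that such a prime is maximal, \<open>c\<close> is chosen as a multiple \<open>x j\<close>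
  of an arbitrary element \<open>x\<close> outside the prime, with \<open>j \<in> J\<close> also outside it; an ideal containing
  the prime and \<open>x\<close> then contains both \<open>1 - y c\<close> and \<open>y c\<close>, hence \<open>1\<close>.\<close>

lemma (in cring) primeideal_imp_maximalideal_if_regular:
  assumes J: "ideal J R" and reg: "\<And>j. j \<in> J \<Longrightarrow> vnr_element R j"
    and P: "primeideal P R" and JP: "\<not> J \<subseteq> P"
  shows "maximalideal P R"
proof -
  interpret J: ideal J R by fact
  interpret P: primeideal P R by fact
  obtain j where j: "j \<in> J" "j \<notin> P" using JP by auto
  then have jc: "j \<in> carrier R" by (simp add: J.Icarr)
  show ?thesis
  proof (rule maximalidealI[OF P.is_ideal P.I_notcarr])
    fix K assume K: "ideal K R" "P \<subseteq> K"
    interpret K: ideal K R by fact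
    show "K = P \<or> K = carrier R"
    proof (rule disjCI)
      assume "K \<noteq> carrier R"
      show "K = P"
      proof (rule ccontr)
        assume "K \<noteq> P"
        then obtain x where x: "x \<in> K" "x \<notin> P" using K by auto
        then have xc: "x \<in> carrier R" by (simp add: K.Icarr)
        let ?c = "x \<otimes> j"
        have cP: "?c \<notin> P" using P.I_prime xc jc x j by blast
        have "vnr_element R ?c" using reg J.I_l_closed j xc by blast
        then obtain y where y: "y \<in> carrier R" "?c \<otimes> y \<otimes> ?c = ?c"
          by (auto simp: vnr_element_def)
        have "?c \<otimes> (\<one> \<ominus> y \<otimes> ?c) = ?c \<ominus> ?c \<otimes> y \<otimes> ?c" using xc jc y(1) by algebra
        also have "\<dots> = \<zero>" unfolding y(2) using xc jc by algebra
        finally have "?c \<otimes> (\<one> \<ominus> y \<otimes> ?c) \<in> P" by simp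
        then have "\<one> \<ominus> y \<otimes> ?c \<in> P" using P.I_prime[of ?c "\<one> \<ominus> y \<otimes> ?c"] cP xc jc y(1) by simp
        then have "\<one> \<ominus> y \<otimes> ?c \<in> K" using K by auto
        moreover have "y \<otimes> ?c \<in> K" using x jc y by (intro K.I_l_closed K.I_r_closed)
        ultimately have "(\<one> \<ominus> y \<otimes> ?c) \<oplus> y \<otimes> ?c \<in> K" by (rule K.a_closed)
        moreover have "(\<one> \<ominus> y \<otimes> ?c) \<oplus> y \<otimes> ?c = \<one>" using xc jc y(1) by algebra
        ultimately have "\<one> \<in> K" by simp
        then show False using K.one_imp_carrier \<open>K \<noteq> carrier R\<close> by simp
      qed
    qed
  qed
qed

text \<open>The elements \<open>j\<^sup>n (1 - j b)\<close> form a multiplicative set. If it omits \<open>0\<close>, some prime \<open>P\<close>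
  avoids it; this prime does not contain \<open>j\<close>, so it is maximal, and \<open>j\<close> is invertible modulo \<open>P\<close>,
  which puts some \<open>1 - j b\<close> into \<open>P\<close> after all. Hence \<open>j\<^sup>n (1 - j b) = 0\<close> for some \<open>n\<close> and \<open>b\<close>. Then
  \<open>j (1 - j b)\<close> is a nilpotent element of \<open>J\<close>, and its vanishing says that \<open>b\<close> is a
  quasi-inverse of \<open>j\<close>.\<close>

lemma (in cring) vnr_element_if_primes_maximal:
  assumes J: "ideal J R" and nil: "Nilp R \<inter> J = {\<zero>}"
    and max: "\<And>P. primeideal P R \<Longrightarrow> \<not> J \<subseteq> P \<Longrightarrow> maximalideal P R"
    and jJ: "j \<in> J"
  shows "vnr_element R j"
proof -
  interpret J: ideal J R by fact
  have j: "j \<in> carrier R" using jJ by (simp add: J.Icarr)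
  define S where "S = {j [^] n \<otimes> (\<one> \<ominus> j \<otimes> b) | (n::nat) b. b \<in> carrier R}"
  have SI: "j [^] n \<otimes> (\<one> \<ominus> j \<otimes> b) \<in> S" if "b \<in> carrier R" for n :: nat and b
    using that by (auto simp: S_def)
  have pow_S: "j [^] n \<in> S" for n :: nat
    using SI[of \<zero> n] j by (simp add: a_minus_def)
  have "\<zero> \<in> S"
  proof (rule ccontr)
    assume "\<zero> \<notin> S"
    then have disj: "{\<zero>} \<inter> S = {}" by simp
    have mult: "s \<otimes> t \<in> S" if "s \<in> S" "t \<in> S" for s t
    proof -
      obtain n m :: nat and b c where
        s: "s = j [^] n \<otimes> (\<one> \<ominus> j \<otimes> b)" "b \<in> carrier R" and
        t: "t = j [^] m \<otimes> (\<one> \<ominus> j \<otimes> c)" "c \<in> carrier R"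
        using \<open>s \<in> S\<close> \<open>t \<in> S\<close> unfolding S_def by blast
      have pows: "j [^] n \<in> carrier R" "j [^] m \<in> carrier R" using j by auto
      \<comment> \<open>\<open>(1 - j b) (1 - j c) = 1 - j (b + c - j b c)\<close> keeps the product of the required form.\<close>
      have "s \<otimes> t = (j [^] n \<otimes> j [^] m) \<otimes> (\<one> \<ominus> j \<otimes> (b \<oplus> c \<ominus> j \<otimes> b \<otimes> c))"
        unfolding s t using pows j s(2) t(2) by algebra
      also have "\<dots> = j [^] (n + m) \<otimes> (\<one> \<ominus> j \<otimes> (b \<oplus> c \<ominus> j \<otimes> b \<otimes> c))"
        using j by (simp add: nat_pow_mult)
      also have "\<dots> \<in> S" using j s(2) t(2) by (intro SI) auto
      finally show ?thesis .
    qed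
    have "S \<subseteq> carrier R" using j by (auto simp: S_def)
    moreover have "\<one> \<in> S" using pow_S[of 0] by simp
    ultimately obtain P where P: "primeideal P R" and PS: "P \<inter> S = {}"
      using exists_primeideal_avoiding[OF zeroideal disj] mult by metis
    have jP: "j \<notin> P" using pow_S[of 1] PS j by auto
    then interpret P: maximalideal P R using max[OF P] jJ by blast
    let ?K = "P <+>\<^bsub>R\<^esub> PIdl j"
    note K = ideal_add_cgenideal[OF P.is_ideal j]
    have "?K \<subseteq> carrier R" using ideal.Icarr[OF K(1)] by blast
    then have "?K = carrier R" using P.I_maximal[OF K(1)] K(3,4) jP by blast
    then obtain p b where p: "p \<in> P" and b: "b \<in> carrier R" and pb: "\<one> = p \<oplus> b \<otimes> j"
      using K(2)[of \<one>] by auto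
    have pc: "p \<in> carrier R" using p by (simp add: P.Icarr)
    have "\<one> \<ominus> j \<otimes> b = (p \<oplus> b \<otimes> j) \<ominus> j \<otimes> b" using pb by simp
    also have "\<dots> = p" using pc b j by algebra
    finally have "p = j [^] (0::nat) \<otimes> (\<one> \<ominus> j \<otimes> b)" using pc by simp
    then show False using SI[OF b, of 0] p PS by auto
  qed
  then obtain n :: nat and b where b: "b \<in> carrier R" and zero: "j [^] n \<otimes> (\<one> \<ominus> j \<otimes> b) = \<zero>"
    unfolding S_def by auto
  let ?u = "\<one> \<ominus> j \<otimes> b"
  have u: "?u \<in> carrier R" using j b by simp
  have "(j \<otimes> ?u) [^] Suc n = (j [^] n \<otimes> ?u) \<otimes> (?u [^] n \<otimes> j)"
    using j u by (simp add: nat_pow_distrib m_ac)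
  also have "\<dots> = \<zero>" unfolding zero using j u by simp
  finally have "j \<otimes> ?u \<in> Nilp R" using j u by (auto simp: Nilp_def intro!: exI[of _ "Suc n"])
  then have eq: "j \<otimes> ?u = \<zero>" using nil J.I_r_closed[OF jJ u] by blast
  have "j \<otimes> b \<otimes> j = j \<ominus> j \<otimes> ?u" using j b by algebra
  also have "\<dots> = j" unfolding eq using j by algebra
  finally show ?thesis using b by (auto simp: vnr_element_def)
qed

lemma (in cring) ideal_regular_iff:
  assumes J: "ideal J R"
  shows "(\<forall>j\<in>J. vnr_element R j) \<longleftrightarrow>
    Nilp R \<inter> J = {\<zero>} \<and> (\<forall>P. primeideal P R \<and> \<not> J \<subseteq> P \<longrightarrow> maximalideal P R)"
proof
  interpret J: ideal J R by fact
  assume reg: "\<forall>j\<in>J. vnr_element R j"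
  have "Nilp R \<inter> J \<subseteq> {\<zero>}" using reg vnr_nilpotent_eq_zero J.Icarr by blast
  moreover have "\<zero> \<in> Nilp R" by (auto simp: Nilp_def intro!: exI[of _ 1])
  ultimately have "Nilp R \<inter> J = {\<zero>}" by auto
  then show "Nilp R \<inter> J = {\<zero>} \<and> (\<forall>P. primeideal P R \<and> \<not> J \<subseteq> P \<longrightarrow> maximalideal P R)"
    using primeideal_imp_maximalideal_if_regular[OF J] reg by blast
qed (use vnr_element_if_primes_maximal[OF J] in blast)

section \<open>The amalgamation as an extension\<close>

context
  fixes A :: "('a, 'm) ring_scheme" and B :: "('b, 'n) ring_scheme"
    and J :: "'b set" and f :: "'a \<Rightarrow> 'b"
  assumes A: "cring A" and B: "cring B" and J: "ideal J B" and f: "f \<in> ring_hom A B"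
begin

interpretation A: cring A by (rule A)
interpretation B: cring B by (rule B)
interpretation J: ideal J B by (rule J)
interpretation f: ring_hom_cring A B f by unfold_locales (rule f)

lemma amalgamation_simps:
  "carrier (amalgamation A B J f) = {(a, f a \<oplus>\<^bsub>B\<^esub> j) | a j. a \<in> carrier A \<and> j \<in> J}"
  "\<one>\<^bsub>amalgamation A B J f\<^esub> = (\<one>\<^bsub>A\<^esub>, \<one>\<^bsub>B\<^esub>)"
  "x \<otimes>\<^bsub>amalgamation A B J f\<^esub> y = (fst x \<otimes>\<^bsub>A\<^esub> fst y, snd x \<otimes>\<^bsub>B\<^esub> snd y)"
  "x \<oplus>\<^bsub>amalgamation A B J f\<^esub> y = (fst x \<oplus>\<^bsub>A\<^esub> fst y, snd x \<oplus>\<^bsub>B\<^esub> snd y)"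
  by (auto simp: amalgamation_def RDirProd_def DirProd_def monoid.defs split: prod.splits)

lemma amalgamation_fst_hom: "ring_hom_cring (amalgamation A B J f) A fst"
proof -
  interpret R: cring "amalgamation A B J f" by (rule amalgamation_cring[OF A B J f])
  show ?thesis
    by unfold_locales (auto simp: ring_hom_def amalgamation_simps)
qed

lemma zero_Pair_mem_amalgamation_iff:
  "(\<zero>\<^bsub>A\<^esub>, b) \<in> carrier (amalgamation A B J f) \<longleftrightarrow> b \<in> J"
  by (auto simp: amalgamation_simps J.Icarr intro!: exI[of _ b])

lemma amalgamation_fst_image: "fst ` carrier (amalgamation A B J f) = carrier A"
proof
  show "carrier A \<subseteq> fst ` carrier (amalgamation A B J f)"
  proof
    fix a assume "a \<in> carrier A"
    then have "(a, f a \<oplus>\<^bsub>B\<^esub> \<zero>\<^bsub>B\<^esub>) \<in> carrier (amalgamation A B J f)"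
      unfolding amalgamation_simps using J.zero_closed by blast
    then show "a \<in> fst ` carrier (amalgamation A B J f)" by (metis fst_conv imageI)
  qed
qed (auto simp: amalgamation_simps)

lemma amalgamation_fst_kernel: "a_kernel (amalgamation A B J f) A fst = Pair \<zero>\<^bsub>A\<^esub> ` J"
proof -
  have "a_kernel (amalgamation A B J f) A fst =
      {(\<zero>\<^bsub>A\<^esub>, b) | b. (\<zero>\<^bsub>A\<^esub>, b) \<in> carrier (amalgamation A B J f)}"
    unfolding a_kernel_def' by auto
  then show ?thesis unfolding zero_Pair_mem_amalgamation_iff by auto
qed

text \<open>A quasi-inverse \<open>y\<close> of \<open>j\<close> need not lie in \<open>J\<close>, but \<open>y j y\<close> is a second quasi-inverse that
  does, and \<open>(0, y j y)\<close> belongs to the amalgamation.\<close>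

lemma vnr_element_amalgamation_iff:
  assumes j: "j \<in> J"
  shows "vnr_element (amalgamation A B J f) (\<zero>\<^bsub>A\<^esub>, j) \<longleftrightarrow> vnr_element B j"
proof
  assume "vnr_element (amalgamation A B J f) (\<zero>\<^bsub>A\<^esub>, j)"
  then show "vnr_element B j"
    by (auto simp: vnr_element_def amalgamation_simps J.Icarr)
next
  assume "vnr_element B j"
  then obtain y where y: "y \<in> carrier B" "j \<otimes>\<^bsub>B\<^esub> y \<otimes>\<^bsub>B\<^esub> j = j" by (auto simp: vnr_element_def)
  have jc: "j \<in> carrier B" using j by (rule J.Icarr)
  let ?z = "y \<otimes>\<^bsub>B\<^esub> j \<otimes>\<^bsub>B\<^esub> y"
  have "j \<otimes>\<^bsub>B\<^esub> ?z \<otimes>\<^bsub>B\<^esub> j = (j \<otimes>\<^bsub>B\<^esub> y \<otimes>\<^bsub>B\<^esub> j) \<otimes>\<^bsub>B\<^esub> y \<otimes>\<^bsub>B\<^esub> j"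
    using jc y(1) by (simp add: B.m_assoc)
  then have "j \<otimes>\<^bsub>B\<^esub> ?z \<otimes>\<^bsub>B\<^esub> j = j" by (simp add: y(2))
  moreover have "?z \<in> J" using j y by (intro J.I_l_closed J.I_r_closed)
  then have "(\<zero>\<^bsub>A\<^esub>, ?z) \<in> carrier (amalgamation A B J f)"
    by (simp add: zero_Pair_mem_amalgamation_iff)
  ultimately show "vnr_element (amalgamation A B J f) (\<zero>\<^bsub>A\<^esub>, j)"
    unfolding vnr_element_def
    by (intro bexI[of _ "(\<zero>\<^bsub>A\<^esub>, ?z)"]) (auto simp: amalgamation_simps)
qed

lemma von_neumann_regular_amalgamation_iff:
  "von_neumann_regular_ring (amalgamation A B J f) \<longleftrightarrow>
    von_neumann_regular_ring A \<and> (\<forall>j\<in>J. vnr_element B j)"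
  using ring_hom_cring.von_neumann_regular_extension[OF amalgamation_fst_hom amalgamation_fst_image]
  by (simp add: amalgamation_fst_kernel vnr_element_amalgamation_iff)

end

theorem theorem2p1:
  fixes A :: "('a, 'm) ring_scheme" and B :: "('b, 'n) ring_scheme"
    and J :: "'b set" and f :: "'a \<Rightarrow> 'b"
  assumes "cring A" and "cring B"
    and "ideal J B"
    and "f \<in> ring_hom A B"
  shows "von_neumann_regular_ring (amalgamation A B J f) \<longleftrightarrow>
    von_neumann_regular_ring A \<and>
    Nilp B \<inter> J = {\<zero>\<^bsub>B\<^esub>} \<and>
    (\<forall>P. primeideal P B \<and> \<not> J \<subseteq> P \<longrightarrow> maximalideal P B)"
  unfolding von_neumann_regular_amalgamation_iff[OF assms]
    cring.ideal_regular_iff[OF assms(2,3)] ..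

end
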